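(* Let $H$ and $G$ be finite graphs with $H\le G$ in $\mathcal{G}$ and $|G|-|H|>2$. Then the interval $[H,G]$ of $\mathcal{G}$ is disconnected if and only if it is strongly zero-split.
   Context: $\mathcal{G}$ is the poset of all finite unlabelled graphs (loops and multiple edges allowed), taken up to isomorphism, with $H\le G$ if and only if $H$ is isomorphic to an induced subgraph of $G$; $|G|$ denotes the number of vertices of $G$. For $x\le y$ the interval is $[x,y]=\{z: x\le z\le y\}$ and its interior is $(x,y)=[x,y]\setminus\{x,y\}$. The interval $[x,y]$ is disconnected if $(x,y)$ can be partitioned into two non-empty sets $A,B$ such that no element of $A$ is comparable to any element of $B$. Occurrences: label the vertices of $G$ arbitrarily by $[|G|]=\{1,\dots,|G|\}$; for $\eta\subseteq[|G|]$ let $G[\eta]$ be the induced subgraph on $\eta$; $\eta$ is an occurrence of $H$ in $G$ if $G[\eta]\cong H$, and $E(H,G)$ is the set of all occurrences of $H$ in $G$. For $\eta\in E(H,G)$ put $Z(\eta)=[|G|]\setminus\eta$, and for $A\subseteq E(H,G)$ put $Z(A)=\bigcup_{\eta\in A}Z(\eta)$. The interval $[H,G]$ is zero-split if $E(H,G)$ can be partitioned into two non-empty disjoint sets $A,B$ with $Z(A)\cap Z(B)=\emptyset$ (a zero-split partition). It is strongly zero-split if there is a zero-split partition $A,B$ such that there do not exist $\eta\in A$, $\phi\in B$, $i\in[|G|]\setminus\eta$ and $j\in[|G|]\setminus\phi$ with $G[\eta\cup\{i\}]\cong G[\phi\cup\{j\}]$. *)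

theory Defs
  imports "HOL-Library.Multiset" "HOL-Library.Uprod"
begin

text \<open>
  Edges form a multiset of unordered pairs: a loop at \<open>v\<close> is \<open>Upair v v\<close>, and parallel edges
  (or parallel loops) are repeated elements. Taking \<^typ>\<open>nat\<close> as vertex type loses no
  isomorphism class of finite graphs.
\<close>

typedef graph =
  "{(V :: nat set, E :: nat uprod multiset). finite V \<and> (\<forall>e \<in># E. set_uprod e \<subseteq> V)}"
proof
  show "({}, {#}) \<in> {(V :: nat set, E :: nat uprod multiset). finite V \<and> (\<forall>e \<in># E. set_uprod e \<subseteq> V)}"
    by simp
qed

setup_lifting type_definition_graph
lifting_forget uprod.lifting

lift_definition verts :: "graph \<Rightarrow> nat set" is fst .

lift_definition edges :: "graph \<Rightarrow> nat uprod multiset" is snd .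

lift_definition induced :: "graph \<Rightarrow> nat set \<Rightarrow> graph"
  is "\<lambda>(V, E) S. (V \<inter> S, filter_mset (\<lambda>e. set_uprod e \<subseteq> S) E)"
  by auto

definition isomorphic :: "graph \<Rightarrow> graph \<Rightarrow> bool" (infix "\<cong>\<^sub>G" 50) where
  "G \<cong>\<^sub>G H \<longleftrightarrow>
     (\<exists>f. bij_betw f (verts G) (verts H) \<and> edges H = image_mset (map_uprod f) (edges G))"

lemma finite_verts [simp]: "finite (verts G)"
  by transfer (simp add: split_beta)

lemma edges_verts: "e \<in># edges G \<Longrightarrow> set_uprod e \<subseteq> verts G"
  by transfer (simp add: split_beta)

lemma graph_eqI: "verts G = verts H \<Longrightarrow> edges G = edges H \<Longrightarrow> G = H"
  by transfer (simp add: prod_eq_iff)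

lemma verts_induced [simp]: "verts (induced G S) = verts G \<inter> S"
  by transfer (simp add: split_beta)

lemma edges_induced [simp]:
  "edges (induced G S) = filter_mset (\<lambda>e. set_uprod e \<subseteq> S) (edges G)"
  by transfer (simp add: split_beta)

lemma induced_verts [simp]: "induced G (verts G) = G"
proof (rule graph_eqI)
  have "filter_mset (\<lambda>e. set_uprod e \<subseteq> verts G) (edges G) = filter_mset (\<lambda>_. True) (edges G)"
    by (rule filter_mset_cong) (auto dest: edges_verts)
  then show "edges (induced G (verts G)) = edges G" by simp
qed simp

lemma induced_induced [simp]: "induced (induced G S) T = induced G (S \<inter> T)"
proof (rule graph_eqI)
  show "edges (induced (induced G S) T) = edges (induced G (S \<inter> T))"
    by (simp add: filter_filter_mset conj_commute)
qed auto

lemma isomorphic_refl [simp]: "G \<cong>\<^sub>G G"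
  unfolding isomorphic_def by (rule exI[of _ id]) (simp add: uprod.map_id0)

lemma isomorphic_sym: "G \<cong>\<^sub>G H \<Longrightarrow> H \<cong>\<^sub>G G"
proof -
  assume "G \<cong>\<^sub>G H"
  then obtain f where f: "bij_betw f (verts G) (verts H)"
    and E: "edges H = image_mset (map_uprod f) (edges G)"
    unfolding isomorphic_def by blast
  let ?g = "inv_into (verts G) f"
  have inj: "inj_on f (verts G)" using f by (rule bij_betw_imp_inj_on)
  have "image_mset (map_uprod ?g) (edges H) = image_mset (\<lambda>e. map_uprod (?g \<circ> f) e) (edges G)"
    unfolding E by (simp add: multiset.map_comp comp_def uprod.map_comp)
  also have "\<dots> = image_mset (\<lambda>e. e) (edges G)"
  proof (rule image_mset_cong)
    fix e assume "e \<in># edges G"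
    then have "set_uprod e \<subseteq> verts G" by (rule edges_verts)
    then have "map_uprod (?g \<circ> f) e = map_uprod id e"
      using inj by (intro uprod.map_cong0) auto
    then show "map_uprod (?g \<circ> f) e = e" by (simp add: uprod.map_id)
  qed
  finally have "edges G = image_mset (map_uprod ?g) (edges H)" by simp
  with bij_betw_inv_into[OF f] show ?thesis unfolding isomorphic_def by blast
qed

lemma isomorphic_trans: "G \<cong>\<^sub>G H \<Longrightarrow> H \<cong>\<^sub>G K \<Longrightarrow> G \<cong>\<^sub>G K"
proof -
  assume "G \<cong>\<^sub>G H" "H \<cong>\<^sub>G K"
  then obtain f g where f: "bij_betw f (verts G) (verts H)"
    and g: "bij_betw g (verts H) (verts K)"
    and E: "edges H = image_mset (map_uprod f) (edges G)"
      "edges K = image_mset (map_uprod g) (edges H)"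
    unfolding isomorphic_def by blast
  have "edges K = image_mset (map_uprod (g \<circ> f)) (edges G)"
    unfolding E by (simp add: multiset.map_comp comp_def uprod.map_comp)
  with bij_betw_trans[OF f g] show ?thesis unfolding isomorphic_def by blast
qed

lemma equivp_isomorphic: "equivp (\<cong>\<^sub>G)"
proof (rule equivpI)
  show "reflp (\<cong>\<^sub>G)" by (rule reflpI) simp
  show "symp (\<cong>\<^sub>G)" by (rule sympI) (rule isomorphic_sym)
  show "transp (\<cong>\<^sub>G)" by (rule transpI) (rule isomorphic_trans)
qed

lemma isomorphic_card: "G \<cong>\<^sub>G H \<Longrightarrow> card (verts G) = card (verts H)"
  unfolding isomorphic_def by (auto dest: bij_betw_same_card)

lemma isomorphic_induced:
  assumes "G \<cong>\<^sub>G H" "S \<subseteq> verts G"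
  shows "\<exists>T \<subseteq> verts H. induced G S \<cong>\<^sub>G induced H T"
proof -
  from assms(1) obtain f where f: "bij_betw f (verts G) (verts H)"
    and E: "edges H = image_mset (map_uprod f) (edges G)"
    unfolding isomorphic_def by blast
  have inj: "inj_on f (verts G)" and im: "f ` verts G = verts H"
    using f by (auto simp: bij_betw_def)
  have T: "f ` S \<subseteq> verts H" using assms(2) im by blast
  have "set_uprod (map_uprod f e) \<subseteq> f ` S \<longleftrightarrow> set_uprod e \<subseteq> S" if "e \<in># edges G" for e
    using edges_verts[OF that] assms(2) inj_on_image_mem_iff[OF inj _ assms(2)]
    unfolding uprod.set_map by blast
  then have "filter_mset (\<lambda>e. set_uprod e \<subseteq> f ` S) (edges H) =
      image_mset (map_uprod f) (filter_mset (\<lambda>e. set_uprod e \<subseteq> S) (edges G))"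
    unfolding E filter_mset_image_mset
    by (intro arg_cong[where f = "image_mset (map_uprod f)"] filter_mset_cong) auto
  moreover have "bij_betw f (verts G \<inter> S) (verts H \<inter> f ` S)"
    using inj T assms(2) by (auto simp: bij_betw_def inf.absorb2 intro: inj_on_subset)
  ultimately have "induced G S \<cong>\<^sub>G induced H (f ` S)"
    unfolding isomorphic_def by (intro exI[of _ f]) simp
  with T show ?thesis by blast
qed

quotient_type ugraph = graph / "(\<cong>\<^sub>G)"
  morphisms rep_ugraph unlabel
  by (rule equivp_isomorphic)

lift_definition usize :: "ugraph \<Rightarrow> nat" is "\<lambda>G. card (verts G)"
  by (rule isomorphic_card)

instantiation ugraph :: order
begin

lift_definition less_eq_ugraph :: "ugraph \<Rightarrow> ugraph \<Rightarrow> bool"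
  is "\<lambda>H G. \<exists>S \<subseteq> verts G. induced G S \<cong>\<^sub>G H"
proof -
  have *: "\<exists>S \<subseteq> verts G'. induced G' S \<cong>\<^sub>G H'"
    if iso: "H \<cong>\<^sub>G H'" "G \<cong>\<^sub>G G'" and ex: "\<exists>S \<subseteq> verts G. induced G S \<cong>\<^sub>G H" for H H' G G'
  proof -
    from ex obtain S where S: "S \<subseteq> verts G" "induced G S \<cong>\<^sub>G H" by blast
    obtain T where "T \<subseteq> verts G'" and T: "induced G S \<cong>\<^sub>G induced G' T"
      using isomorphic_induced[OF iso(2) S(1)] by blast
    moreover have "induced G' T \<cong>\<^sub>G H'"
      using isomorphic_trans[OF isomorphic_trans[OF isomorphic_sym[OF T] S(2)] iso(1)] .
    ultimately show ?thesis by blast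
  qed
  show "(\<exists>S \<subseteq> verts G. induced G S \<cong>\<^sub>G H) \<longleftrightarrow> (\<exists>S \<subseteq> verts G'. induced G' S \<cong>\<^sub>G H')"
    if "H \<cong>\<^sub>G H'" "G \<cong>\<^sub>G G'" for H H' G G'
    using *[OF that] *[OF that[THEN isomorphic_sym]] by blast
qed

definition less_ugraph :: "ugraph \<Rightarrow> ugraph \<Rightarrow> bool" where
  "less_ugraph H G \<longleftrightarrow> H \<le> G \<and> \<not> G \<le> H"

instance
proof
  show "x < y \<longleftrightarrow> x \<le> y \<and> \<not> y \<le> x" for x y :: ugraph
    by (rule less_ugraph_def)
  show "x \<le> x" for x :: ugraph
  proof transfer
    show "\<exists>S \<subseteq> verts G. induced G S \<cong>\<^sub>G G" for G
      by (intro exI[of _ "verts G"]) simp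
  qed
  show "x \<le> z" if "x \<le> y" "y \<le> z" for x y z :: ugraph
    using that
  proof transfer
    fix H G K
    assume "\<exists>S \<subseteq> verts G. induced G S \<cong>\<^sub>G H" "\<exists>S \<subseteq> verts K. induced K S \<cong>\<^sub>G G"
    then obtain S T where S: "S \<subseteq> verts G" "induced G S \<cong>\<^sub>G H"
      and T: "T \<subseteq> verts K" "induced K T \<cong>\<^sub>G G" by blast
    obtain R where "R \<subseteq> verts (induced K T)" "induced G S \<cong>\<^sub>G induced (induced K T) R"
      using isomorphic_induced[OF isomorphic_sym[OF T(2)] S(1)] by blast
    then have "T \<inter> R \<subseteq> verts K" "induced K (T \<inter> R) \<cong>\<^sub>G H"
      using T(1) isomorphic_trans[OF isomorphic_sym S(2)] by auto
    then show "\<exists>S \<subseteq> verts K. induced K S \<cong>\<^sub>G H" by blast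
  qed
  show "x = y" if "x \<le> y" "y \<le> x" for x y :: ugraph
    using that
  proof transfer
    fix H G
    assume "\<exists>S \<subseteq> verts G. induced G S \<cong>\<^sub>G H" "\<exists>S \<subseteq> verts H. induced H S \<cong>\<^sub>G G"
    then obtain S T where S: "S \<subseteq> verts G" "induced G S \<cong>\<^sub>G H"
      and T: "T \<subseteq> verts H" "induced H T \<cong>\<^sub>G G" by blast
    have "card S = card (verts H)" "card T = card (verts G)"
      using isomorphic_card[OF S(2)] isomorphic_card[OF T(2)] S(1) T(1)
      by (auto simp: inf.absorb2)
    moreover have "card T \<le> card (verts H)" using T(1) by (simp add: card_mono)
    ultimately have "S = verts G" using S(1) by (intro card_seteq) auto
    then show "H \<cong>\<^sub>G G" using S(2) by (simp add: isomorphic_sym)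
  qed
qed

end

definition disconnected_interval :: "'a :: order \<Rightarrow> 'a \<Rightarrow> bool" where
  "disconnected_interval x y \<longleftrightarrow>
     (\<exists>A B. A \<noteq> {} \<and> B \<noteq> {} \<and> A \<inter> B = {} \<and> A \<union> B = {x..y} - {x, y} \<and>
        (\<forall>a \<in> A. \<forall>b \<in> B. \<not> a \<le> b \<and> \<not> b \<le> a))"

text \<open>
  The vertices of an unlabelled graph have no names, so the notions about occurrences below take
  a labelling \<open>L\<close> of the upper end of the interval instead of that unlabelled graph itself.
\<close>

definition labelling :: "graph \<Rightarrow> ugraph \<Rightarrow> bool" where
  "labelling L G \<longleftrightarrow> unlabel L = G \<and> verts L = {1..usize G}"

lemma ex_labelling: "\<exists>L. labelling L G"
proof -
  have "\<exists>L. K \<cong>\<^sub>G L \<and> verts L = {1..card (verts K)}" for K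
  proof -
    obtain f where f: "bij_betw f (verts K) {1..card (verts K)}"
      using finite_same_card_bij[of "verts K" "{1..card (verts K)}"] by auto
    define L where
      "L = Abs_graph ({1..card (verts K)}, image_mset (map_uprod f) (edges K))"
    have "\<forall>e \<in># image_mset (map_uprod f) (edges K). set_uprod e \<subseteq> {1..card (verts K)}"
      using edges_verts[of _ K] f by (fastforce simp: uprod.set_map bij_betw_def)
    then have "Rep_graph L = ({1..card (verts K)}, image_mset (map_uprod f) (edges K))"
      unfolding L_def by (subst Abs_graph_inverse) auto
    then have "verts L = {1..card (verts K)}" "edges L = image_mset (map_uprod f) (edges K)"
      by (simp_all add: verts.rep_eq edges.rep_eq)
    with f have "K \<cong>\<^sub>G L \<and> verts L = {1..card (verts K)}"
      unfolding isomorphic_def by auto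
    then show ?thesis ..
  qed
  then have "\<exists>L. L \<cong>\<^sub>G K \<and> verts L = {1..card (verts K)}" for K
    using isomorphic_sym by blast
  moreover obtain K where "G = unlabel K"
    by (induction G rule: ugraph.abs_induct) blast
  ultimately show ?thesis
    unfolding labelling_def by (simp add: ugraph.abs_eq_iff usize.abs_eq)
qed

definition occurrences :: "ugraph \<Rightarrow> graph \<Rightarrow> nat set set" where
  "occurrences H L = {\<eta>. \<eta> \<subseteq> verts L \<and> unlabel (induced L \<eta>) = H}"

definition zeros :: "graph \<Rightarrow> nat set \<Rightarrow> nat set" where
  "zeros L \<eta> = verts L - \<eta>"

definition zero_split_partition ::
    "ugraph \<Rightarrow> graph \<Rightarrow> nat set set \<Rightarrow> nat set set \<Rightarrow> bool" where
  "zero_split_partition H L A B \<longleftrightarrow>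
     A \<noteq> {} \<and> B \<noteq> {} \<and> A \<inter> B = {} \<and> A \<union> B = occurrences H L \<and>
     (\<Union>\<eta> \<in> A. zeros L \<eta>) \<inter> (\<Union>\<phi> \<in> B. zeros L \<phi>) = {}"

definition strongly_zero_split :: "ugraph \<Rightarrow> graph \<Rightarrow> bool" where
  "strongly_zero_split H L \<longleftrightarrow>
     (\<exists>A B. zero_split_partition H L A B \<and>
        \<not> (\<exists>\<eta> \<in> A. \<exists>\<phi> \<in> B. \<exists>i \<in> verts L - \<eta>. \<exists>j \<in> verts L - \<phi>.
              induced L (\<eta> \<union> {i}) \<cong>\<^sub>G induced L (\<phi> \<union> {j})))"

end

theory Submission
  imports Defs
begin

text \<open>
  The interior of \<open>[H, G]\<close> is the union, over the occurrences \<open>\<eta>\<close> of \<open>H\<close>, of the images under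
  \<open>S \<mapsto> G[S]\<close> of the open Boolean intervals \<open>(\<eta>, V)\<close>, where \<open>V\<close> is the vertex set. As
  \<open>|V - \<eta>| > 2\<close>, each of these intervals is connected, so disconnecting \<open>[H, G]\<close> amounts to
  splitting the occurrences into two classes whose images are incomparable.

  If \<open>v\<close> is a common zero of \<open>\<eta> \<in> A\<close> and \<open>\<phi> \<in> B\<close>, then \<open>G[V - {v}]\<close> lies in both images, and so
  does a common one-vertex extension of \<open>\<eta>\<close> and \<open>\<phi>\<close>. Conversely, let \<open>G[S] \<le> G[T]\<close> with
  \<open>\<eta> \<subset> S\<close>, \<open>\<phi> \<subset> T\<close>. Then \<open>T\<close> contains a copy \<open>\<eta>' \<union> {j}\<close> of some \<open>\<eta> \<union> {i}\<close>. Either \<open>\<eta>' \<in> B\<close>, and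
  \<open>\<eta>\<close>, \<open>\<eta>'\<close> share a one-vertex extension, or \<open>\<eta>' \<in> A\<close>, and every vertex outside \<open>T\<close> is a common
  zero of \<open>\<eta>'\<close> and \<open>\<phi>\<close>.
\<close>

definition incomparable :: "'a::order set \<Rightarrow> 'a set \<Rightarrow> bool" where
  "incomparable A B \<longleftrightarrow> (\<forall>a \<in> A. \<forall>b \<in> B. \<not> a \<le> b \<and> \<not> b \<le> a)"

lemma incomparableD: "incomparable A B \<Longrightarrow> a \<in> A \<Longrightarrow> b \<in> B \<Longrightarrow> \<not> a \<le> b \<and> \<not> b \<le> a"
  by (simp add: incomparable_def)

lemma incomparable_disjoint: "incomparable A B \<Longrightarrow> A \<inter> B = {}"
  by (auto simp: incomparable_def)

lemma disconnected_interval_iff: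
  "disconnected_interval x y \<longleftrightarrow>
     (\<exists>A B. A \<noteq> {} \<and> B \<noteq> {} \<and> A \<union> B = {x<..<y} \<and> incomparable A B)"
proof -
  have interior: "{x..y} - {x, y} = {x<..<y}" by (auto simp: order.strict_iff_order)
  show ?thesis
    unfolding disconnected_interval_def interior incomparable_def[symmetric]
    by (intro ex_cong1) (auto dest: incomparable_disjoint)
qed

lemma mono_image_on_one_side:
  assumes conn: "\<not> disconnected_interval x y"
    and mono: "mono_on {x<..<y} f"
    and cover: "f ` {x<..<y} \<subseteq> P \<union> Q"
    and incomp: "incomparable P Q"
  shows "f ` {x<..<y} \<subseteq> P \<or> f ` {x<..<y} \<subseteq> Q"
proof (rule ccontr)
  let ?A = "{z \<in> {x<..<y}. f z \<in> P}" and ?B = "{z \<in> {x<..<y}. f z \<in> Q}"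
  assume "\<not> ?thesis"
  then have "?A \<noteq> {}" "?B \<noteq> {}" using cover by blast+
  moreover have "?A \<union> ?B = {x<..<y}" using cover by blast
  moreover have "incomparable ?A ?B"
    using incomp mono_onD[OF mono] unfolding incomparable_def by blast
  ultimately have "disconnected_interval x y"
    unfolding disconnected_interval_iff by (intro exI[of _ ?A] exI[of _ ?B] conjI)
  with conn show False ..
qed

lemma Un_in_set_interval:
  assumes "U \<subseteq> V" "X \<subseteq> V - U" "X \<noteq> {}" "card X < card (V - U)"
  shows "U \<union> X \<in> {U<..<V}"
proof -
  have "X \<noteq> V - U" using assms(4) by auto
  with assms(1-3) show ?thesis by auto
qed

lemma not_disconnected_set_interval:
  assumes "card (V - U) > 2"
  shows "\<not> disconnected_interval U V"
proof
  assume "disconnected_interval U V"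
  then obtain A B where cover: "A \<union> B = {U<..<V}" and incomp: "incomparable A B"
    and "A \<noteq> {}" "B \<noteq> {}"
    unfolding disconnected_interval_iff by blast
  then obtain S T where S: "S \<in> A" and T: "T \<in> B" by blast
  with cover have "S \<in> {U<..<V}" "T \<in> {U<..<V}" by blast+
  then have between: "U \<subset> S" "S \<subset> V" "U \<subset> T" "T \<subset> V" by simp_all
  then obtain i j where i: "i \<in> S - U" and j: "j \<in> T - U" by blast
  have "card {i, j} < card (V - U)" using assms by (simp add: card_insert_if)
  then have ij: "U \<union> {i, j} \<in> A \<union> B"
    unfolding cover using between i j by (intro Un_in_set_interval) auto
  have "U \<union> {i} \<in> A \<union> B" "U \<union> {j} \<in> A \<union> B"
    unfolding cover using between i j by auto
  moreover have "U \<union> {i} \<subseteq> S" "U \<union> {j} \<subseteq> T" using between i j by auto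
  then have "U \<union> {i} \<notin> B" "U \<union> {j} \<notin> A"
    using incomparableD[OF incomp S] incomparableD[OF incomp _ T] by blast+
  ultimately have "U \<union> {i} \<in> A" "U \<union> {j} \<in> B" by blast+
  then have "U \<union> {i, j} \<notin> B" "U \<union> {i, j} \<notin> A"
    using incomparableD[OF incomp] by blast+
  with ij show False by blast
qed

abbreviation uinduced :: "graph \<Rightarrow> nat set \<Rightarrow> ugraph" where
  "uinduced L S \<equiv> unlabel (induced L S)"

lemma usize_uinduced: "S \<subseteq> verts L \<Longrightarrow> usize (uinduced L S) = card S"
  by (simp add: usize.abs_eq inf.absorb2)

lemma le_unlabel_iff: "K \<le> unlabel L \<longleftrightarrow> (\<exists>S \<subseteq> verts L. uinduced L S = K)"
  by (induction K rule: ugraph.abs_induct) (simp add: less_eq_ugraph.abs_eq ugraph.abs_eq_iff)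

lemma le_uinduced_iff:
  assumes "T \<subseteq> verts L"
  shows "K \<le> uinduced L T \<longleftrightarrow> (\<exists>S \<subseteq> T. uinduced L S = K)"
proof -
  have "verts (induced L T) = T" using assms by auto
  moreover have "induced (induced L T) S = induced L S" if "S \<subseteq> T" for S
    using that by (simp add: inf.absorb2)
  ultimately show ?thesis unfolding le_unlabel_iff by metis
qed

lemma uinduced_mono: "S \<subseteq> T \<Longrightarrow> T \<subseteq> verts L \<Longrightarrow> uinduced L S \<le> uinduced L T"
  by (auto simp: le_uinduced_iff)

lemma less_uinduced_iff:
  assumes "T \<subseteq> verts L"
  shows "K < uinduced L T \<longleftrightarrow> (\<exists>S \<subset> T. uinduced L S = K)"
proof -
  have "uinduced L S \<noteq> uinduced L T" if "S \<subset> T" for S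
  proof -
    have "card S < card T"
      using that assms by (meson finite_subset finite_verts psubset_card_mono)
    then have "usize (uinduced L S) < usize (uinduced L T)"
      using that assms by (simp add: usize_uinduced psubset_imp_subset[THEN subset_trans])
    then show ?thesis by auto
  qed
  then show ?thesis
    unfolding order.strict_iff_order le_uinduced_iff[OF assms] by blast
qed

lemma card_zeros:
  assumes "\<eta> \<in> occurrences H L"
  shows "card (zeros L \<eta>) = usize (unlabel L) - usize H"
proof -
  have "\<eta> \<subseteq> verts L" "usize H = card \<eta>"
    using assms usize_uinduced[of \<eta> L] by (auto simp: occurrences_def)
  then show ?thesis
    by (simp add: zeros_def usize.abs_eq card_Diff_subset finite_subset[OF _ finite_verts])
qed

definition proper_extensions :: "graph \<Rightarrow> nat set set \<Rightarrow> ugraph set" where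
  "proper_extensions L A = (\<Union>\<eta> \<in> A. uinduced L ` {\<eta><..<verts L})"

definition one_vertex_extensions :: "graph \<Rightarrow> nat set set \<Rightarrow> ugraph set" where
  "one_vertex_extensions L A = (\<Union>\<eta> \<in> A. (\<lambda>i. uinduced L (\<eta> \<union> {i})) ` zeros L \<eta>)"

lemma mem_proper_extensions_iff:
  "K \<in> proper_extensions L A \<longleftrightarrow>
     (\<exists>\<eta> \<in> A. \<exists>S. \<eta> \<subset> S \<and> S \<subset> verts L \<and> uinduced L S = K)"
  by (simp only: proper_extensions_def UN_iff image_iff greaterThanLessThan_iff Bex_def conj_assoc
      eq_commute[of K])

lemma proper_extensions_Un:
  "proper_extensions L (A \<union> B) = proper_extensions L A \<union> proper_extensions L B"
  by (simp add: proper_extensions_def)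

lemma proper_extensions_occurrences:
  "proper_extensions L (occurrences H L) = {H<..<unlabel L}"
proof (rule set_eqI)
  fix K
  have "K \<in> {H<..<unlabel L} \<longleftrightarrow> (\<exists>S \<subset> verts L. uinduced L S = K \<and> H < uinduced L S)"
    using less_uinduced_iff[of "verts L" L K] by auto
  also have "\<dots> \<longleftrightarrow> (\<exists>S \<subset> verts L. uinduced L S = K \<and> (\<exists>\<eta> \<subset> S. uinduced L \<eta> = H))"
    by (intro ex_cong1 conj_cong refl less_uinduced_iff psubset_imp_subset)
  also have "\<dots> \<longleftrightarrow> K \<in> proper_extensions L (occurrences H L)"
    unfolding mem_proper_extensions_iff occurrences_def by (auto dest: psubset_trans)
  finally show "K \<in> proper_extensions L (occurrences H L) \<longleftrightarrow> K \<in> {H<..<unlabel L}" by simp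
qed

lemma one_vertex_in_set_interval:
  assumes "usize H + 1 < usize (unlabel L)" "\<eta> \<in> occurrences H L" "i \<in> zeros L \<eta>"
  shows "\<eta> \<union> {i} \<in> {\<eta><..<verts L}"
proof (rule Un_in_set_interval)
  show "\<eta> \<subseteq> verts L" "{i} \<subseteq> verts L - \<eta>"
    using assms(2,3) by (auto simp: occurrences_def zeros_def)
  show "card {i} < card (verts L - \<eta>)"
    using assms(1) card_zeros[OF assms(2)] by (simp add: zeros_def)
qed simp

lemma minus_vertex_in_set_interval:
  assumes "usize H + 1 < usize (unlabel L)" "\<eta> \<in> occurrences H L" "v \<in> zeros L \<eta>"
  shows "verts L - {v} \<in> {\<eta><..<verts L}"
proof -
  have "\<eta> \<union> {v} \<noteq> verts L" using one_vertex_in_set_interval[OF assms] by (simp add: psubset_eq)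
  then show ?thesis using assms(2,3) by (auto simp: zeros_def occurrences_def)
qed

lemma one_vertex_subset_proper_extensions:
  assumes "usize H + 1 < usize (unlabel L)" "A \<subseteq> occurrences H L"
  shows "one_vertex_extensions L A \<subseteq> proper_extensions L A"
proof -
  have "(\<lambda>i. \<eta> \<union> {i}) ` zeros L \<eta> \<subseteq> {\<eta><..<verts L}" if "\<eta> \<in> A" for \<eta>
    using one_vertex_in_set_interval[OF assms(1)] assms(2) that by blast
  then show ?thesis unfolding one_vertex_extensions_def proper_extensions_def by blast
qed

lemma zeros_nonempty:
  assumes "usize H < usize (unlabel L)" "\<eta> \<in> occurrences H L"
  shows "zeros L \<eta> \<noteq> {}"
proof
  assume "zeros L \<eta> = {}"
  with card_zeros[OF assms(2)] assms(1) show False by simp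
qed

lemma proper_extensions_nonempty:
  assumes size: "usize H + 1 < usize (unlabel L)" and A: "A \<subseteq> occurrences H L" "A \<noteq> {}"
  shows "proper_extensions L A \<noteq> {}"
proof -
  obtain \<eta> where "\<eta> \<in> A" using A by blast
  moreover from this have "zeros L \<eta> \<noteq> {}" using size A by (intro zeros_nonempty[of H]) auto
  ultimately have "one_vertex_extensions L A \<noteq> {}" by (auto simp: one_vertex_extensions_def)
  then show ?thesis using one_vertex_subset_proper_extensions[OF size A(1)] by blast
qed

lemma proper_extensions_on_one_side:
  assumes "usize H + 2 < usize (unlabel L)"
    and "\<eta> \<in> occurrences H L"
    and cover: "P \<union> Q = {H<..<unlabel L}"
    and incomp: "incomparable P Q"
  shows "proper_extensions L {\<eta>} \<subseteq> P \<or> proper_extensions L {\<eta>} \<subseteq> Q"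
proof -
  have "\<not> disconnected_interval \<eta> (verts L)"
    using assms(1) card_zeros[OF assms(2)]
    by (intro not_disconnected_set_interval) (simp add: zeros_def)
  moreover have "mono_on {\<eta><..<verts L} (uinduced L)"
    by (intro mono_onI uinduced_mono) auto
  moreover have "uinduced L ` {\<eta><..<verts L} \<subseteq> P \<union> Q"
    using assms(2) unfolding cover proper_extensions_occurrences[symmetric] proper_extensions_def
    by blast
  ultimately show ?thesis
    using mono_image_on_one_side[OF _ _ _ incomp] by (simp add: proper_extensions_def)
qed

lemma disconnected_interval_iff_occurrences:
  assumes size: "usize H + 2 < usize (unlabel L)"
  shows "disconnected_interval H (unlabel L) \<longleftrightarrow>
    (\<exists>A B. A \<noteq> {} \<and> B \<noteq> {} \<and> A \<union> B = occurrences H L \<and>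
       incomparable (proper_extensions L A) (proper_extensions L B))"
    (is "_ \<longleftrightarrow> ?split")
proof
  assume "disconnected_interval H (unlabel L)"
  then obtain P Q where nonempty: "P \<noteq> {}" "Q \<noteq> {}"
    and cover: "P \<union> Q = {H<..<unlabel L}" and incomp: "incomparable P Q"
    unfolding disconnected_interval_iff by blast
  define below where "below R = {\<eta> \<in> occurrences H L. proper_extensions L {\<eta>} \<subseteq> R}" for R
  have occ: "below P \<union> below Q = occurrences H L"
    using proper_extensions_on_one_side[OF size _ cover incomp] by (auto simp: below_def)
  have side: "proper_extensions L (below R) \<subseteq> R" for R
    by (auto simp: below_def proper_extensions_def)
  moreover have "proper_extensions L (below P) \<union> proper_extensions L (below Q) = P \<union> Q"
    unfolding proper_extensions_Un[symmetric] occ cover by (rule proper_extensions_occurrences)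
  ultimately have eq: "proper_extensions L (below P) = P" "proper_extensions L (below Q) = Q"
    using side[of P] side[of Q] incomparable_disjoint[OF incomp] by blast+
  with nonempty have "below P \<noteq> {}" "below Q \<noteq> {}" by (auto simp: proper_extensions_def)
  moreover have "incomparable (proper_extensions L (below P)) (proper_extensions L (below Q))"
    unfolding eq by (rule incomp)
  ultimately show ?split using occ by blast
next
  assume ?split
  then obtain A B where nonempty: "A \<noteq> {}" "B \<noteq> {}" and occ: "A \<union> B = occurrences H L"
    and incomp: "incomparable (proper_extensions L A) (proper_extensions L B)" by blast
  have "proper_extensions L A \<noteq> {}" "proper_extensions L B \<noteq> {}"
    using proper_extensions_nonempty[of H L] size nonempty occ by auto
  moreover have "proper_extensions L A \<union> proper_extensions L B = {H<..<unlabel L}"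
    unfolding proper_extensions_Un[symmetric] occ by (rule proper_extensions_occurrences)
  ultimately show "disconnected_interval H (unlabel L)"
    using incomp unfolding disconnected_interval_iff by blast
qed

lemma one_vertex_extension_within:
  assumes T: "T \<subseteq> verts L" and K: "H \<le> K" "K \<le> uinduced L T" "usize K = Suc (usize H)"
  obtains \<eta> where "\<eta> \<in> occurrences H L" "\<eta> \<subseteq> T" "K \<in> one_vertex_extensions L {\<eta>}"
proof -
  obtain W where W: "W \<subseteq> T" "uinduced L W = K" using K(2) by (auto simp: le_uinduced_iff[OF T])
  have "W \<subseteq> verts L" using W T by blast
  moreover obtain \<eta> where \<eta>: "\<eta> \<subseteq> W" "uinduced L \<eta> = H"
    using K(1) unfolding W(2)[symmetric] le_uinduced_iff[OF \<open>W \<subseteq> verts L\<close>] by blast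
  ultimately have "card W = Suc (card \<eta>)"
    using usize_uinduced[of W L] usize_uinduced[of \<eta> L] K(3) W(2) by simp
  then have "card (W - \<eta>) = 1"
    using \<eta>(1) card_ge_0_finite[of W] by (simp add: card_Diff_subset finite_subset)
  then obtain i where "W - \<eta> = {i}" by (auto simp: card_1_singleton_iff)
  then have i: "i \<in> zeros L \<eta>" "W = \<eta> \<union> {i}" using \<eta>(1) \<open>W \<subseteq> verts L\<close> by (auto simp: zeros_def)
  show thesis
  proof (rule that)
    show "\<eta> \<in> occurrences H L" "\<eta> \<subseteq> T"
      using \<eta> W \<open>W \<subseteq> verts L\<close> by (auto simp: occurrences_def)
    show "K \<in> one_vertex_extensions L {\<eta>}"
      using W(2) i by (auto simp: one_vertex_extensions_def)
  qed
qed

lemma proper_extension_contains_one_vertex_extension: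
  assumes A: "A \<subseteq> occurrences H L" and x: "x \<in> proper_extensions L A"
  obtains K where "K \<in> one_vertex_extensions L A" "H \<le> K" "K \<le> x" "usize K = Suc (usize H)"
proof -
  obtain \<eta> S where \<eta>: "\<eta> \<in> A" "\<eta> \<subset> S" and S: "S \<subset> verts L" "x = uinduced L S"
    using x unfolding mem_proper_extensions_iff by blast
  then obtain i where i: "i \<in> S" "i \<notin> \<eta>" by blast
  have H: "\<eta> \<subseteq> verts L" "uinduced L \<eta> = H" using A \<eta>(1) by (auto simp: occurrences_def)
  have sub: "\<eta> \<union> {i} \<subseteq> verts L" using \<eta> S i by blast
  show thesis
  proof (rule that)
    show "uinduced L (\<eta> \<union> {i}) \<in> one_vertex_extensions L A"
      using \<eta> S i by (auto simp: one_vertex_extensions_def zeros_def)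
    show "H \<le> uinduced L (\<eta> \<union> {i})" using uinduced_mono[OF _ sub, of \<eta>] H(2) by auto
    show "uinduced L (\<eta> \<union> {i}) \<le> x" using \<eta> S i by (auto intro: uinduced_mono)
    show "usize (uinduced L (\<eta> \<union> {i})) = Suc (usize H)"
      using usize_uinduced[OF sub] usize_uinduced[OF H(1)] H i finite_subset[OF H(1)] by simp
  qed
qed

lemma proper_extensions_not_le:
  assumes zsp: "zero_split_partition H L A B"
    and disjoint: "one_vertex_extensions L A \<inter> one_vertex_extensions L B = {}"
    and x: "x \<in> proper_extensions L A" and y: "y \<in> proper_extensions L B"
  shows "\<not> x \<le> y"
proof
  assume "x \<le> y"
  have occ: "A \<union> B = occurrences H L"
    and zeros_disjoint: "\<And>\<eta> \<phi>. \<eta> \<in> A \<Longrightarrow> \<phi> \<in> B \<Longrightarrow> zeros L \<eta> \<inter> zeros L \<phi> = {}"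
    using zsp by (auto simp: zero_split_partition_def)
  obtain K where K: "K \<in> one_vertex_extensions L A" "H \<le> K" "K \<le> x" "usize K = Suc (usize H)"
    using proper_extension_contains_one_vertex_extension[OF _ x] occ by blast
  obtain \<phi> T where \<phi>: "\<phi> \<in> B" "\<phi> \<subset> T" and T: "T \<subset> verts L" "y = uinduced L T"
    using y unfolding mem_proper_extensions_iff by blast
  have "K \<le> uinduced L T" using K(3) \<open>x \<le> y\<close> T(2) by simp
  then obtain \<eta> where \<eta>: "\<eta> \<in> occurrences H L" "\<eta> \<subseteq> T" "K \<in> one_vertex_extensions L {\<eta>}"
    using one_vertex_extension_within[OF psubset_imp_subset[OF T(1)] K(2) _ K(4)] by blast
  have "\<eta> \<notin> B" using \<eta>(3) K(1) disjoint by (auto simp: one_vertex_extensions_def)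
  then have "\<eta> \<in> A" using \<eta>(1) occ by blast
  moreover obtain v where "v \<in> verts L - T" using T(1) by blast
  then have "v \<in> zeros L \<eta> \<inter> zeros L \<phi>" using \<eta>(2) \<phi>(2) by (auto simp: zeros_def)
  ultimately show False using zeros_disjoint \<phi>(1) by blast
qed

lemma zero_split_partition_sym: "zero_split_partition H L A B \<Longrightarrow> zero_split_partition H L B A"
  by (auto simp: zero_split_partition_def)

lemma incomparable_proper_extensions_iff:
  assumes size: "usize H + 1 < usize (unlabel L)"
    and nonempty: "A \<noteq> {}" "B \<noteq> {}" and occ: "A \<union> B = occurrences H L"
  shows "incomparable (proper_extensions L A) (proper_extensions L B) \<longleftrightarrow>
    zero_split_partition H L A B \<and> one_vertex_extensions L A \<inter> one_vertex_extensions L B = {}"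
proof
  assume "incomparable (proper_extensions L A) (proper_extensions L B)"
  then have disjoint: "proper_extensions L A \<inter> proper_extensions L B = {}"
    by (rule incomparable_disjoint)
  have zeros_disjoint: "zeros L \<eta> \<inter> zeros L \<phi> = {}" if "\<eta> \<in> A" "\<phi> \<in> B" for \<eta> \<phi>
  proof (rule ccontr)
    assume "zeros L \<eta> \<inter> zeros L \<phi> \<noteq> {}"
    then obtain v where "v \<in> zeros L \<eta>" "v \<in> zeros L \<phi>" by blast
    then have "uinduced L (verts L - {v}) \<in> proper_extensions L A \<inter> proper_extensions L B"
      using minus_vertex_in_set_interval[OF size] that occ unfolding proper_extensions_def by blast
    with disjoint show False by blast
  qed
  moreover have "A \<inter> B = {}"
    using zeros_disjoint zeros_nonempty[of H L] size occ by fastforce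
  ultimately have "zero_split_partition H L A B"
    using nonempty occ unfolding zero_split_partition_def by blast
  moreover have "one_vertex_extensions L A \<inter> one_vertex_extensions L B = {}"
    using disjoint one_vertex_subset_proper_extensions[OF size] occ by blast
  ultimately show "zero_split_partition H L A B \<and>
    one_vertex_extensions L A \<inter> one_vertex_extensions L B = {}" by blast
next
  assume "zero_split_partition H L A B \<and> one_vertex_extensions L A \<inter> one_vertex_extensions L B = {}"
  then show "incomparable (proper_extensions L A) (proper_extensions L B)"
    using proper_extensions_not_le[of H L A B] proper_extensions_not_le[of H L B A]
      zero_split_partition_sym unfolding incomparable_def by blast
qed

lemma strongly_zero_split_iff:
  "strongly_zero_split H L \<longleftrightarrow>
     (\<exists>A B. zero_split_partition H L A B \<and>
        one_vertex_extensions L A \<inter> one_vertex_extensions L B = {})"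
proof -
  have "one_vertex_extensions L A \<inter> one_vertex_extensions L B = {} \<longleftrightarrow>
    \<not> (\<exists>\<eta> \<in> A. \<exists>\<phi> \<in> B. \<exists>i \<in> verts L - \<eta>. \<exists>j \<in> verts L - \<phi>.
         induced L (\<eta> \<union> {i}) \<cong>\<^sub>G induced L (\<phi> \<union> {j}))" for A B
    unfolding one_vertex_extensions_def zeros_def ugraph.abs_eq_iff[symmetric] by blast
  then show ?thesis unfolding strongly_zero_split_def by simp
qed

theorem theorem2p3:
  fixes H G :: ugraph and L :: graph
  assumes "labelling L G"
    and "H \<le> G"
    and "int (usize G) - int (usize H) > 2"
  shows "disconnected_interval H G \<longleftrightarrow> strongly_zero_split H L"
proof -
  have G: "G = unlabel L" using assms(1) by (simp add: labelling_def)
  with assms(3) have size: "usize H + 2 < usize (unlabel L)" by simp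
  have split_iff: "A \<noteq> {} \<and> B \<noteq> {} \<and> A \<union> B = occurrences H L \<and>
      incomparable (proper_extensions L A) (proper_extensions L B) \<longleftrightarrow>
    zero_split_partition H L A B \<and> one_vertex_extensions L A \<inter> one_vertex_extensions L B = {}"
    for A B
    using incomparable_proper_extensions_iff[of H L A B] size
    by (auto simp: zero_split_partition_def)
  show ?thesis
    unfolding G disconnected_interval_iff_occurrences[OF size] split_iff strongly_zero_split_iff ..
qed

end
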